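(* Let $D$ be the formal derivative with respect to the context-free grammar $$G\colon\ x\to xy,\quad y\to zu,\quad z\to zw,\quad w\to xv,\quad u\to xyz^{-1}v,\quad v\to x^{-1}zwu$$ over the variable set $\{x,y,z,w,u,v\}$. Then for every $n\ge0$, $$D^n(z)=P_n(x,y,z,w,u,v).$$
   Context: The formal derivative $D$ with respect to the grammar $G$ is the linear operator on Laurent polynomials in $x,y,z,w,u,v$ that kills constants, satisfies the product rule $D(fg)=D(f)g+fD(g)$, and satisfies $D(x)=xy$, $D(y)=zu$, $D(z)=zw$, $D(w)=xv$, $D(u)=xyz^{-1}v$, $D(v)=x^{-1}zwu$. For a permutation $\pi=\pi_1\cdots\pi_n$ of $[n]=\{1,\dots,n\}$ put $\pi_0=0$. An index $1\le i\le n-1$ is an exterior peak if $\pi_{i-1}<\pi_i>\pi_{i+1}$; it is of pattern 132 if moreover $\pi_{i-1}<\pi_{i+1}$, and of pattern 231 if moreover $\pi_{i-1}>\pi_{i+1}$. An index $2\le i\le n-1$ is a proper double descent if $\pi_{i-1}>\pi_i>\pi_{i+1}$. Let $P_n(i,j,k)$ be the number of permutations of $[n]$ with $i$ exterior peaks of pattern 132, $j$ exterior peaks of pattern 231 and $k$ proper double descents, and $$P_n(x,y,z,w,u,v)=\sum_{i,j,k=0}^{n}P_n(i,j,k)\,x^iv^iu^jz^{j+1}y^kw^{n-2i-2j-k}$$ (so $P_0=z$). *)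

theory Defs
  imports "HOL-Library.Poly_Mapping" "HOL-Combinatorics.Permutations"
begin

section \<open>Laurent polynomials\<close>

text \<open>
  A Laurent monomial is its exponent vector, a finitely supported function into the integers; the
  ring structure on the type below is the convolution product of \<^theory>\<open>HOL-Library.Poly_Mapping\<close>.
\<close>

type_synonym ('v, 'a) laurent = "('v \<Rightarrow>\<^sub>0 int) \<Rightarrow>\<^sub>0 'a"

definition const :: "'a::comm_ring_1 \<Rightarrow> ('v, 'a) laurent" where
  "const c = Poly_Mapping.single 0 c"

definition var_pow :: "'v \<Rightarrow> int \<Rightarrow> ('v, 'a::comm_ring_1) laurent" where
  "var_pow a e = Poly_Mapping.single (Poly_Mapping.single a e) 1"

definition var :: "'v \<Rightarrow> ('v, 'a::comm_ring_1) laurent" where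
  "var a = var_pow a 1"

lemma const_0 [simp]: "const 0 = 0"
  by (simp add: const_def)

lemma const_1 [simp]: "const 1 = 1"
  by (simp add: const_def)

lemma const_add: "const (c + d) = const c + const d"
  by (simp add: const_def single_add)

lemma const_mult: "const (c * d) = const c * const d"
  by (simp add: const_def mult_single)

lemma var_pow_0 [simp]: "var_pow a 0 = 1"
  by (simp add: var_pow_def)

lemma var_pow_add: "var_pow a (d + e) = var_pow a d * var_pow a e"
  by (simp add: var_pow_def mult_single single_add)

lemma var_pow_of_nat: "var_pow a (int k) = var a ^ k"
  by (induction k) (simp_all add: var_pow_add var_def)

lemma var_inverse: "var a * var_pow a (-1) = 1"
  unfolding var_def by (simp flip: var_pow_add)

lemma poly_mapping_add_induct [case_names zero single add]:
  fixes f :: "'k \<Rightarrow>\<^sub>0 'b::comm_monoid_add"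
  assumes zero: "P 0"
    and single: "\<And>k c. P (Poly_Mapping.single k c)"
    and add: "\<And>f g. P f \<Longrightarrow> P g \<Longrightarrow> P (f + g)"
  shows "P f"
proof (induction f rule: update_induct)
  case const
  show ?case by (fact zero)
next
  case (update f a b)
  have "Poly_Mapping.update a b f = Poly_Mapping.single a b + f"
    using update.hyps(1)
    by (intro poly_mapping_eqI) (auto simp: lookup_update lookup_add lookup_single in_keys_iff when_def)
  then show ?case
    using add[OF single update.IH] by simp
qed

section \<open>The formal derivative of a context-free grammar\<close>

text \<open>
  A grammar is the function sending each variable to the right-hand side of its substitution rule.
\<close>

definition is_formal_derivative ::
    "('v \<Rightarrow> ('v, 'a::comm_ring_1) laurent) \<Rightarrow> (('v, 'a) laurent \<Rightarrow> ('v, 'a) laurent) \<Rightarrow> bool" where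
  "is_formal_derivative G D \<longleftrightarrow>
     (\<forall>f g. D (f + g) = D f + D g) \<and>
     (\<forall>c f. D (const c * f) = const c * D f) \<and>
     (\<forall>c. D (const c) = 0) \<and>
     (\<forall>f g. D (f * g) = D f * g + f * D g) \<and>
     (\<forall>a. D (var a) = G a)"

text \<open>Well-definedness of this description is the lemma \<open>ex1_formal_derivative\<close> below.\<close>

definition formal_derivative ::
    "('v \<Rightarrow> ('v, 'a::comm_ring_1) laurent) \<Rightarrow> ('v, 'a) laurent \<Rightarrow> ('v, 'a) laurent" where
  "formal_derivative G = (THE D. is_formal_derivative G D)"

subsection \<open>Existence and uniqueness\<close>

text \<open>The Euler operator \<open>a \<cdot> \<partial>/\<partial>a\<close>.\<close>

lift_definition euler :: "'v \<Rightarrow> ('v, 'a::comm_ring_1) laurent \<Rightarrow> ('v, 'a) laurent" is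
  "\<lambda>a f m. of_int (Poly_Mapping.lookup m a) * f m"
  by (rule finite_subset) auto

lemma lookup_euler:
  "Poly_Mapping.lookup (euler a f) m = of_int (Poly_Mapping.lookup m a) * Poly_Mapping.lookup f m"
  by (simp add: euler.rep_eq)

lemma euler_0 [simp]: "euler a 0 = 0"
  by (rule poly_mapping_eqI) (simp add: lookup_euler)

lemma euler_add: "euler a (f + g) = euler a f + euler a g"
  by (rule poly_mapping_eqI) (simp add: lookup_euler lookup_add algebra_simps)

lemma euler_single:
  "euler a (Poly_Mapping.single m c) = Poly_Mapping.single m (of_int (Poly_Mapping.lookup m a) * c)"
  by (rule poly_mapping_eqI) (simp add: lookup_euler lookup_single when_def)

lemma euler_const: "euler a (const c) = 0"
  by (simp add: const_def euler_single)

lemma euler_mult: "euler a (f * g) = euler a f * g + f * euler a g"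
proof (induction f rule: poly_mapping_add_induct)
  case (single m c)
  show ?case
    by (induction g rule: poly_mapping_add_induct)
      (simp_all add: euler_single mult_single lookup_add euler_add algebra_simps flip: single_add)
qed (simp_all add: euler_add algebra_simps)

lemma euler_var: "euler a (var b) = (if a = b then var b else 0)"
  by (simp add: var_def var_pow_def euler_single lookup_single when_def)

lemma formal_derivative_exists:
  fixes G :: "'v::finite \<Rightarrow> ('v, 'a::comm_ring_1) laurent"
  shows "\<exists>D. is_formal_derivative G D"
proof -
  define D where "D f = (\<Sum>a\<in>UNIV. euler a f * (var_pow a (-1) * G a))" for f
  have mult: "D (f * g) = D f * g + f * D g" for f g
    unfolding D_def
    by (simp add: euler_mult algebra_simps sum.distrib sum_distrib_left sum_distrib_right)
  have const: "D (const c) = 0" for c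
    by (simp add: D_def euler_const)
  have var: "D (var b) = G b" for b
  proof -
    have "D (var b) = (\<Sum>a\<in>UNIV. if a = b then var b * (var_pow b (-1) * G b) else 0)"
      unfolding D_def by (intro sum.cong) (simp_all add: euler_var)
    also have "\<dots> = var b * var_pow b (-1) * G b"
      by (simp add: mult.assoc)
    finally show ?thesis
      by (simp add: var_inverse)
  qed
  have "is_formal_derivative G D"
    unfolding is_formal_derivative_def
    by (simp add: mult const var) (simp add: D_def euler_add sum.distrib algebra_simps)
  then show ?thesis by (rule exI[of _ D])
qed

lemma formal_derivative_unique:
  fixes G :: "'v \<Rightarrow> ('v, 'a::comm_ring_1) laurent"
  assumes "is_formal_derivative G D" "is_formal_derivative G D'"
  shows "D = D'"
proof -
  define E where "E f = D f - D' f" for f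
  have E_add: "E (f + g) = E f + E g" for f g
    using assms by (simp add: E_def is_formal_derivative_def)
  have E_mult: "E (f * g) = E f * g + f * E g" for f g
    using assms by (simp add: E_def is_formal_derivative_def algebra_simps)
  have E_const: "E (const c) = 0" for c
    using assms by (simp add: E_def is_formal_derivative_def)
  have E_var: "E (var a) = 0" for a
    using assms by (simp add: E_def is_formal_derivative_def)
  have E_1: "E 1 = 0"
    using E_const[of 1] by simp
  have E_0: "E 0 = 0"
    using E_const[of 0] by simp
  have E_inv: "E (var_pow a (-1)) = 0" for a
  proof -
    have "0 = E (var a * var_pow a (-1))"
      by (simp add: var_inverse E_1)
    also have "\<dots> = var a * E (var_pow a (-1))"
      by (simp add: E_mult E_var)
    finally have "var_pow a (-1) * (var a * E (var_pow a (-1))) = 0"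
      by simp
    moreover have "var_pow a (-1) * (var a * E (var_pow a (-1)))
                   = (var a * var_pow a (-1)) * E (var_pow a (-1))"
      by (simp only: ac_simps)
    ultimately show ?thesis
      by (simp add: var_inverse)
  qed
  have E_pow: "E (var_pow a e) = 0" for a e
  proof (induction e rule: int_induct[where k = 0])
    case base
    show ?case by (simp add: E_1)
  next
    case (step1 i)
    then show ?case
      using E_var[of a] by (simp add: var_pow_add E_mult var_def)
  next
    case (step2 i)
    have "(var_pow a (i - 1) :: ('v, 'a) laurent) = var_pow a i * var_pow a (-1)"
      by (simp flip: var_pow_add)
    with step2 E_inv[of a] show ?case
      by (simp add: E_mult)
  qed
  have E_monomial: "E (Poly_Mapping.single m 1) = 0" for m
  proof (induction m rule: poly_mapping_add_induct)
    case zero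
    show ?case by (simp add: E_1)
  next
    case (single a e)
    show ?case using E_pow[of a e] by (simp add: var_pow_def)
  next
    case (add m m')
    have "Poly_Mapping.single (m + m') (1::'a)
          = Poly_Mapping.single m 1 * Poly_Mapping.single m' 1"
      by (simp add: mult_single)
    then show ?case
      by (simp add: E_mult add.IH)
  qed
  have "E f = 0" for f
  proof (induction f rule: poly_mapping_add_induct)
    case zero
    show ?case by (fact E_0)
  next
    case (single m c)
    have "Poly_Mapping.single m c = const c * Poly_Mapping.single m 1"
      by (simp add: const_def mult_single)
    then show ?case
      by (simp add: E_mult E_const E_monomial)
  next
    case (add f g)
    then show ?case by (simp add: E_add)
  qed
  then show ?thesis
    by (simp add: E_def fun_eq_iff)
qed

lemma ex1_formal_derivative:
  fixes G :: "'v::finite \<Rightarrow> ('v, 'a::comm_ring_1) laurent"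
  shows "\<exists>!D. is_formal_derivative G D"
  using formal_derivative_exists formal_derivative_unique by blast

lemma is_formal_derivative_formal_derivative:
  fixes G :: "'v::finite \<Rightarrow> ('v, 'a::comm_ring_1) laurent"
  shows "is_formal_derivative G (formal_derivative G)"
  unfolding formal_derivative_def by (rule theI'[of "is_formal_derivative G"]) (rule ex1_formal_derivative)

lemma
  fixes G :: "'v::finite \<Rightarrow> ('v, 'a::comm_ring_1) laurent"
  shows formal_derivative_add:
      "formal_derivative G (f + g) = formal_derivative G f + formal_derivative G g"
    and formal_derivative_scale:
      "formal_derivative G (const c * f) = const c * formal_derivative G f"
    and formal_derivative_const: "formal_derivative G (const c) = 0"
    and formal_derivative_mult:
      "formal_derivative G (f * g) = formal_derivative G f * g + f * formal_derivative G g"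
    and formal_derivative_var: "formal_derivative G (var a) = G a"
  using is_formal_derivative_formal_derivative[of G] by (simp_all add: is_formal_derivative_def)

section \<open>The peak and descent grammar\<close>

datatype letter = X | Y | Z | W | U | V

instance letter :: finite
proof
  have "(UNIV :: letter set) = {X, Y, Z, W, U, V}"
    using letter.exhaust by blast
  then show "finite (UNIV :: letter set)"
    by (metis finite.emptyI finite_insert)
qed

fun peak_grammar :: "letter \<Rightarrow> (letter, 'a::comm_ring_1) laurent" where
  "peak_grammar X = var X * var Y"
| "peak_grammar Y = var Z * var U"
| "peak_grammar Z = var Z * var W"
| "peak_grammar W = var X * var V"
| "peak_grammar U = var X * var Y * var_pow Z (-1) * var V"
| "peak_grammar V = var_pow X (-1) * var Z * var W * var U"

section \<open>Permutation statistics\<close>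

text \<open>
  A permutation of \<open>[n]\<close> is a function \<open>\<pi>\<close> with \<open>\<pi> permutes {1..n}\<close>. Such a function fixes
  everything outside \<open>{1..n}\<close>, so the convention \<open>\<pi> 0 = 0\<close> holds automatically.
\<close>

definition exterior_peaks :: "nat \<Rightarrow> (nat \<Rightarrow> nat) \<Rightarrow> nat set" where
  "exterior_peaks n \<pi> = {i. 1 \<le> i \<and> i < n \<and> \<pi> (i - 1) < \<pi> i \<and> \<pi> i > \<pi> (i + 1)}"

definition exterior_peaks_132 :: "nat \<Rightarrow> (nat \<Rightarrow> nat) \<Rightarrow> nat set" where
  "exterior_peaks_132 n \<pi> = {i \<in> exterior_peaks n \<pi>. \<pi> (i - 1) < \<pi> (i + 1)}"

definition exterior_peaks_231 :: "nat \<Rightarrow> (nat \<Rightarrow> nat) \<Rightarrow> nat set" where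
  "exterior_peaks_231 n \<pi> = {i \<in> exterior_peaks n \<pi>. \<pi> (i - 1) > \<pi> (i + 1)}"

definition proper_double_descents :: "nat \<Rightarrow> (nat \<Rightarrow> nat) \<Rightarrow> nat set" where
  "proper_double_descents n \<pi> = {i. 2 \<le> i \<and> i < n \<and> \<pi> (i - 1) > \<pi> i \<and> \<pi> i > \<pi> (i + 1)}"

definition peak_count :: "nat \<Rightarrow> nat \<Rightarrow> nat \<Rightarrow> nat \<Rightarrow> nat" where
  "peak_count n i j k =
     card {\<pi>. \<pi> permutes {1..n} \<and> card (exterior_peaks_132 n \<pi>) = i \<and>
              card (exterior_peaks_231 n \<pi>) = j \<and> card (proper_double_descents n \<pi>) = k}"

definition peak_poly :: "nat \<Rightarrow> (letter, 'a::comm_ring_1) laurent" where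
  "peak_poly n =
     (\<Sum>i = 0..n. \<Sum>j = 0..n. \<Sum>k = 0..n.
        of_nat (peak_count n i j k) * var X ^ i * var V ^ i * var U ^ j * var Z ^ (j + 1) * var Y ^ k
          * var_pow W (int n - 2 * int i - 2 * int j - int k))"

end

theory Submission
  imports Defs
begin

text \<open>
  The grammar records how the statistics change when a new maximum is inserted into a permutation.
  The word \<open>\<pi>\<^sub>0 \<pi>\<^sub>1 \<dots> \<pi>\<^sub>n\<close> has \<open>n + 1\<close> gaps: gap \<open>q < n\<close> lies between \<open>\<pi>\<^sub>q\<close> and
  \<open>\<pi>\<^sub>q\<^sub>+\<^sub>1\<close>, and gap \<open>n\<close> lies at the end. Each gap carries a letter (\<open>gap_label\<close>): the two gaps around
  an exterior peak carry \<open>x, v\<close> if its pattern is 132 and \<open>u, z\<close> if its pattern is 231; the gap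
  after a proper double descent carries \<open>y\<close>; the end carries \<open>z\<close>; every other gap carries \<open>w\<close>. Counting
  letters shows that the product of all labels is exactly the monomial by which \<open>\<pi>\<close> contributes
  to the peak polynomial (\<open>prod_gap_label\<close>), the exponent of \<open>w\<close> being forced because there are
  \<open>n + 1\<close> gaps.

  Inserting \<open>n + 1\<close> into gap \<open>p\<close> changes the labels only near that gap, and the effect on the product
  is to replace the label of gap \<open>p\<close> by the right-hand side of its substitution rule
  (\<open>prod_gap_label_insert_max\<close>). For example, a peak with its surrounding gaps labelled \<open>x, v\<close> or
  \<open>u, z\<close> turns into three gaps labelled \<open>x, v, y\<close> if the insertion takes place before the peak, and
  into \<open>w, u, z\<close> if it takes place after it. When the insertion thus changes \<open>u, z\<close> to \<open>x, v, y\<close> or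
  \<open>x, v\<close> to \<open>w, u, z\<close>, the partner of the replaced label disappears as well, which is why the rules
  for \<open>u\<close> and \<open>v\<close> contain \<open>z\<close> and \<open>x\<close> to the power \<open>-1\<close>.

  By the product rule, \<open>D\<close> maps the product of the labels of \<open>\<pi>\<close> to the sum of the label products of the
  \<open>n + 1\<close> permutations obtained from \<open>\<pi>\<close> by inserting \<open>n + 1\<close>. Every permutation of \<open>[n + 1]\<close>
  arises exactly once in this way (\<open>bij_betw_insert_max\<close>), so the theorem follows by induction on \<open>n\<close>.
\<close>

section \<open>The product rule for finite products\<close>

lemma formal_derivative_sum:
  fixes G :: "'v::finite \<Rightarrow> ('v, 'a::comm_ring_1) laurent"
  shows "formal_derivative G (sum f S) = (\<Sum>s\<in>S. formal_derivative G (f s))"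
proof -
  have "formal_derivative G 0 = 0"
    using formal_derivative_const[of G 0] by simp
  then show ?thesis
    by (induction S rule: infinite_finite_induct) (simp_all add: formal_derivative_add)
qed

lemma formal_derivative_prod:
  fixes G :: "'v::finite \<Rightarrow> ('v, 'a::comm_ring_1) laurent"
  assumes "finite S"
  shows "formal_derivative G (prod f S) = (\<Sum>s\<in>S. formal_derivative G (f s) * prod f (S - {s}))"
  using assms
proof (induction S rule: finite_induct)
  case empty
  show ?case using formal_derivative_const[of G 1] by simp
next
  case (insert a S)
  have "prod f (insert a S - {s}) = f a * prod f (S - {s})" if "s \<in> S" for s
  proof -
    have "insert a S - {s} = insert a (S - {s})"
      using that insert.hyps by auto
    then show ?thesis
      using insert.hyps by simp
  qed
  then have "(\<Sum>s\<in>S. formal_derivative G (f s) * prod f (insert a S - {s}))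
      = f a * (\<Sum>s\<in>S. formal_derivative G (f s) * prod f (S - {s}))"
    by (simp add: sum_distrib_left mult.left_commute)
  with insert show ?case
    by (simp add: formal_derivative_mult)
qed

section \<open>Labelling the gaps of a permutation\<close>

text \<open>
  The labels are expressed through comparisons of nearby entries instead of the sets of peaks and
  double descents, so that the effect of an insertion on them becomes a local case distinction.
  The truncated \<open>q - 1\<close> is harmless: gap \<open>0\<close> of a nonempty permutation is always an ascent.
\<close>

definition gap_label :: "nat \<Rightarrow> (nat \<Rightarrow> nat) \<Rightarrow> nat \<Rightarrow> letter" where
  "gap_label n \<pi> q =
     (if q = n then Z
      else if \<pi> q < \<pi> (q + 1) then
        if q + 1 < n \<and> \<pi> (q + 2) < \<pi> (q + 1) then if \<pi> q < \<pi> (q + 2) then X else U else W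
      else if \<pi> (q - 1) < \<pi> q then if \<pi> (q - 1) < \<pi> (q + 1) then V else Z
      else Y)"

lemma permutes_0:
  assumes "\<pi> permutes {1..n::nat}"
  shows "\<pi> 0 = 0"
  using assms by (rule permutes_not_in) simp

lemma permutes_pos:
  assumes "\<pi> permutes {1..n::nat}" "q > 0"
  shows "\<pi> q > 0"
  by (metis assms permutes_0 permutes_def gr0I)

lemma permutes_neq:
  assumes "\<pi> permutes {1..n::nat}" "a \<noteq> b"
  shows "\<pi> a \<noteq> \<pi> b"
  using assms by (meson injD permutes_inj)

lemma permutes_le:
  assumes "\<pi> permutes {1..n::nat}" "q \<le> n"
  shows "\<pi> q \<le> n"
  using assms permutes_0[OF assms(1)] permutes_in_image[OF assms(1), of q]
  by (cases "q = 0") auto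

lemma gap_label_eq_iff:
  assumes "\<pi> permutes {1..n}" "q < n"
  shows gap_label_eq_V: "gap_label n \<pi> q = V \<longleftrightarrow> q \<in> exterior_peaks_132 n \<pi>"
    and gap_label_eq_Z: "gap_label n \<pi> q = Z \<longleftrightarrow> q \<in> exterior_peaks_231 n \<pi>"
    and gap_label_eq_Y: "gap_label n \<pi> q = Y \<longleftrightarrow> q \<in> proper_double_descents n \<pi>"
    and gap_label_eq_X: "gap_label n \<pi> q = X \<longleftrightarrow> Suc q \<in> exterior_peaks_132 n \<pi>"
    and gap_label_eq_U: "gap_label n \<pi> q = U \<longleftrightarrow> Suc q \<in> exterior_peaks_231 n \<pi>"
proof -
  note defs = gap_label_def exterior_peaks_def exterior_peaks_132_def exterior_peaks_231_def
    proper_double_descents_def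
  have neq: "\<pi> r \<noteq> \<pi> (Suc r)" "\<pi> r \<noteq> \<pi> (Suc (Suc r))" for r
    by (simp_all add: permutes_neq[OF assms(1)])
  have first: "\<pi> 0 < \<pi> (Suc 0)"
    using permutes_0[OF assms(1)] permutes_pos[OF assms(1), of "Suc 0"] by simp
  consider "q = 0" | "q = 1" | r where "q = Suc r" "r > 0"
    by (metis One_nat_def gr0I not0_implies_Suc)
  then show "gap_label n \<pi> q = V \<longleftrightarrow> q \<in> exterior_peaks_132 n \<pi>"
    "gap_label n \<pi> q = Z \<longleftrightarrow> q \<in> exterior_peaks_231 n \<pi>"
    "gap_label n \<pi> q = Y \<longleftrightarrow> q \<in> proper_double_descents n \<pi>"
    "gap_label n \<pi> q = X \<longleftrightarrow> Suc q \<in> exterior_peaks_132 n \<pi>"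
    "gap_label n \<pi> q = U \<longleftrightarrow> Suc q \<in> exterior_peaks_231 n \<pi>"
    using assms(2) first neq[of q] neq[of "Suc q"] neq[of "q - 1"]
    by (cases; auto simp: defs)+
qed

text \<open>
  The letters \<open>x, v\<close> and \<open>u, z\<close> occur in adjacent pairs, one pair for each exterior peak; only the
  \<open>z\<close> at the end has no partner. A partner on the left exists for every \<open>v\<close> and every other \<open>z\<close>
  because gap \<open>0\<close> is an ascent.
\<close>

lemma gap_label_X_next:
  assumes "gap_label n \<pi> q = X"
  shows "q + 1 < n" "\<pi> q < \<pi> (q + 1)" "gap_label n \<pi> (q + 1) = V"
  using assms by (auto simp: gap_label_def split: if_splits)

lemma gap_label_U_next:
  assumes "gap_label n \<pi> q = U"
  shows "q + 1 < n" "\<pi> q < \<pi> (q + 1)" "gap_label n \<pi> (q + 1) = Z"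
  using assms by (auto simp: gap_label_def split: if_splits)

lemma gap_label_V_Z_prev:
  assumes \<pi>: "\<pi> permutes {1..n}" and q: "q < n" and label: "gap_label n \<pi> q \<in> {V, Z}"
  shows "\<not> \<pi> q < \<pi> (q + 1)"
    and "\<exists>r. q = Suc r \<and> gap_label n \<pi> r = (if gap_label n \<pi> q = V then X else U)"
proof -
  have neq: "\<pi> (q - 1) \<noteq> \<pi> (q + 1)"
    by (rule permutes_neq[OF \<pi>]) auto
  show desc: "\<not> \<pi> q < \<pi> (q + 1)"
    using q label by (auto simp: gap_label_def split: if_splits)
  then have "q \<noteq> 0"
    using permutes_0[OF \<pi>] permutes_pos[OF \<pi>, of 1] by (cases "q = 0") auto
  then obtain r where "q = Suc r"
    using not0_implies_Suc by blast
  then show "\<exists>r. q = Suc r \<and> gap_label n \<pi> r = (if gap_label n \<pi> q = V then X else U)"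
    using q label desc neq permutes_neq[OF \<pi>, of q "q + 1"]
    by (auto simp: gap_label_def split: if_splits)
qed

lemma statistics_subset:
  shows "exterior_peaks_132 n \<pi> \<subseteq> {1..<n}"
    and "exterior_peaks_231 n \<pi> \<subseteq> {1..<n}"
    and "proper_double_descents n \<pi> \<subseteq> {1..<n}"
  by (auto simp: exterior_peaks_def exterior_peaks_132_def exterior_peaks_231_def
      proper_double_descents_def)

lemma card_Suc_vimage:
  assumes "S \<subseteq> {1..<n}"
  shows "card {q. q \<le> n \<and> Suc q \<in> S} = card S"
proof -
  have "S = Suc ` {q. q \<le> n \<and> Suc q \<in> S}"
  proof (intro equalityI subsetI)
    fix s assume "s \<in> S"
    moreover from this assms have "s \<ge> 1" "s < n" by auto
    ultimately show "s \<in> Suc ` {q. q \<le> n \<and> Suc q \<in> S}"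
      by (intro image_eqI[of _ _ "s - 1"]) auto
  qed auto
  then show ?thesis
    by (metis card_image inj_Suc inj_on_subset subset_UNIV)
qed

lemma UNIV_letter: "(UNIV :: letter set) = {X, Y, Z, W, U, V}"
  using letter.exhaust by blast

lemma prod_var_eq_powers:
  assumes "finite S"
  shows "(\<Prod>q\<in>S. var (L q)) = (\<Prod>a\<in>(UNIV :: letter set). var a ^ card {q\<in>S. L q = a})"
proof -
  have "(\<Prod>q\<in>S. var (L q)) = (\<Prod>a\<in>UNIV. \<Prod>q\<in>{q\<in>S. L q = a}. var (L q))"
    by (rule prod.group[symmetric]) (use assms in auto)
  also have "\<dots> = (\<Prod>a\<in>UNIV. var a ^ card {q\<in>S. L q = a})"
    by (intro prod.cong refl) simp
  finally show ?thesis .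
qed

lemma card_eq_sum_letters:
  assumes "finite S"
  shows "card S = (\<Sum>a\<in>(UNIV :: letter set). card {q\<in>S. L q = a})"
  using sum.group[OF assms finite_UNIV, of L "\<lambda>_. 1 :: nat"] by simp

lemma prod_gap_label:
  assumes "\<pi> permutes {1..n}"
  defines "i \<equiv> card (exterior_peaks_132 n \<pi>)"
    and "j \<equiv> card (exterior_peaks_231 n \<pi>)"
    and "k \<equiv> card (proper_double_descents n \<pi>)"
  shows "(\<Prod>q\<le>n. var (gap_label n \<pi> q)) =
    var X ^ i * var V ^ i * var U ^ j * var Z ^ (j + 1) * var Y ^ k
      * (var_pow W (int n - 2 * int i - 2 * int j - int k) :: (letter, 'a::comm_ring_1) laurent)"
proof -
  define N where "N a = card {q\<in>{..n}. gap_label n \<pi> q = a}" for a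
  note eq = gap_label_eq_V[OF assms(1)] gap_label_eq_Z[OF assms(1)] gap_label_eq_Y[OF assms(1)]
    gap_label_eq_X[OF assms(1)] gap_label_eq_U[OF assms(1)]
  have last: "gap_label n \<pi> n = Z"
    by (simp add: gap_label_def)
  note sub = statistics_subset[of n \<pi>]
  have V: "{q\<in>{..n}. gap_label n \<pi> q = V} = exterior_peaks_132 n \<pi>"
    using sub last eq by (force simp: le_less)
  have Y: "{q\<in>{..n}. gap_label n \<pi> q = Y} = proper_double_descents n \<pi>"
    using sub last eq by (force simp: le_less)
  have Z: "{q\<in>{..n}. gap_label n \<pi> q = Z} = insert n (exterior_peaks_231 n \<pi>)"
    using sub last eq by (force simp: le_less)
  have X: "{q\<in>{..n}. gap_label n \<pi> q = X} = {q. q \<le> n \<and> Suc q \<in> exterior_peaks_132 n \<pi>}"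
    using sub last eq by (force simp: le_less)
  have U: "{q\<in>{..n}. gap_label n \<pi> q = U} = {q. q \<le> n \<and> Suc q \<in> exterior_peaks_231 n \<pi>}"
    using sub last eq by (force simp: le_less)
  have N: "N X = i" "N V = i" "N U = j" "N Y = k"
    unfolding N_def X V U Y using sub by (simp_all add: i_def j_def k_def card_Suc_vimage)
  have "n \<notin> exterior_peaks_231 n \<pi>" "finite (exterior_peaks_231 n \<pi>)"
    using sub finite_subset[OF sub(2)] by auto
  then have NZ: "N Z = j + 1"
    unfolding N_def Z by (simp add: j_def)
  \<comment> \<open>The last count, that of \<open>W\<close>, follows from the total number of gaps.\<close>
  have "n + 1 = (\<Sum>a\<in>UNIV. N a)"
    using card_eq_sum_letters[of "{..n}" "gap_label n \<pi>"] by (simp add: N_def)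
  then have "int n - 2 * int i - 2 * int j - int k = int (N W)"
    by (simp add: UNIV_letter N NZ)
  then have W: "var_pow W (int n - 2 * int i - 2 * int j - int k)
      = (var W ^ N W :: (letter, 'a) laurent)"
    by (simp only: var_pow_of_nat)
  have "(\<Prod>q\<le>n. var (gap_label n \<pi> q)) = (\<Prod>a\<in>UNIV. var a ^ N a :: (letter, 'a) laurent)"
    unfolding N_def by (rule prod_var_eq_powers) simp
  also have "\<dots> = var X ^ i * var V ^ i * var U ^ j * var Z ^ (j + 1) * var Y ^ k * var W ^ N W"
    by (simp add: UNIV_letter N NZ ac_simps)
  finally show ?thesis
    unfolding W .
qed

text \<open>
  The index bounds \<open>n\<close> in the peak polynomial lose nothing, since each statistic counts positions
  below \<open>n\<close>.
\<close>

lemma peak_poly_eq_sum_gap_labels: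
  "(peak_poly n :: (letter, 'a::comm_ring_1) laurent) =
     (\<Sum>\<pi> | \<pi> permutes {1..n}. \<Prod>q\<le>n. var (gap_label n \<pi> q))"
proof -
  define M :: "nat \<times> nat \<times> nat \<Rightarrow> (letter, 'a) laurent" where
    "M = (\<lambda>(i, j, k). var X ^ i * var V ^ i * var U ^ j * var Z ^ (j + 1) * var Y ^ k
           * var_pow W (int n - 2 * int i - 2 * int j - int k))"
  define g where "g \<pi> = (card (exterior_peaks_132 n \<pi>), card (exterior_peaks_231 n \<pi>),
    card (proper_double_descents n \<pi>))" for \<pi>
  let ?P = "{\<pi>. \<pi> permutes {1..n}}" and ?T = "{0..n} \<times> {0..n} \<times> {0..n}"
  have fin: "finite ?P"
    by (simp add: finite_permutations)
  have le: "card S \<le> n" if "S \<subseteq> {1..<n}" for S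
    using card_mono[OF _ that] by simp
  have "g ` ?P \<subseteq> ?T"
    by (auto simp: g_def intro!: le statistics_subset)
  have "peak_poly n = (\<Sum>(i, j, k)\<in>?T. of_nat (peak_count n i j k) * M (i, j, k))"
    by (simp add: peak_poly_def M_def sum.cartesian_product mult.assoc)
  also have "\<dots> = (\<Sum>t\<in>?T. \<Sum>\<pi>\<in>{\<pi>\<in>?P. g \<pi> = t}. M (g \<pi>))"
    by (intro sum.cong refl) (auto simp: peak_count_def g_def)
  also have "\<dots> = (\<Sum>\<pi>\<in>?P. M (g \<pi>))"
    by (rule sum.group) (use fin \<open>g ` ?P \<subseteq> ?T\<close> in auto)
  also have "\<dots> = (\<Sum>\<pi>\<in>?P. \<Prod>q\<le>n. var (gap_label n \<pi> q))"
    by (intro sum.cong refl) (simp add: prod_gap_label M_def g_def)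
  finally show ?thesis .
qed

section \<open>Inserting a new maximum\<close>

text \<open>
  Insertion of \<open>n + 1\<close> into gap \<open>p\<close> is precomposition with the cycle below: \<open>\<pi>\<close> already
  fixes \<open>n + 1\<close>, and the cycle moves this fixed point to position \<open>p + 1\<close>. In this form the
  result is visibly a permutation, and insertion at a given gap is visibly invertible.
\<close>

definition insertion_cycle :: "nat \<Rightarrow> nat \<Rightarrow> nat \<Rightarrow> nat" where
  "insertion_cycle n p i = (if i = p + 1 then n + 1 else if p + 1 < i \<and> i \<le> n + 1 then i - 1 else i)"

definition insert_max :: "nat \<Rightarrow> nat \<Rightarrow> (nat \<Rightarrow> nat) \<Rightarrow> nat \<Rightarrow> nat" where
  "insert_max n p \<pi> = \<pi> \<circ> insertion_cycle n p"

lemma insertion_cycle_permutes: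
  assumes "p \<le> n"
  shows "insertion_cycle n p permutes {1..n + 1}"
proof (rule bij_imp_permutes)
  show "bij_betw (insertion_cycle n p) {1..n + 1} {1..n + 1}"
    by (rule bij_betw_byWitness
        [where f' = "\<lambda>i. if i = n + 1 then p + 1 else if p < i \<and> i \<le> n then i + 1 else i"])
      (use assms in \<open>auto simp: insertion_cycle_def\<close>)
qed (use assms in \<open>auto simp: insertion_cycle_def\<close>)

lemma insert_max_permutes:
  assumes "\<pi> permutes {1..n}" "p \<le> n"
  shows "insert_max n p \<pi> permutes {1..n + 1}"
  unfolding insert_max_def
  by (rule permutes_compose[OF insertion_cycle_permutes permutes_subset]) (use assms in auto)

lemma insert_max_before: "i \<le> p \<Longrightarrow> insert_max n p \<pi> i = \<pi> i"
  by (simp add: insert_max_def insertion_cycle_def)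

lemma insert_max_at:
  assumes "\<pi> permutes {1..n}"
  shows "insert_max n p \<pi> (p + 1) = n + 1"
  using permutes_not_in[OF assms, of "n + 1"] by (simp add: insert_max_def insertion_cycle_def)

lemma insert_max_after: "p < i \<Longrightarrow> i \<le> n \<Longrightarrow> insert_max n p \<pi> (i + 1) = \<pi> i"
  by (simp add: insert_max_def insertion_cycle_def)

lemma bij_betw_insert_max:
  "bij_betw (\<lambda>(\<pi>, p). insert_max n p \<pi>) ({\<pi>. \<pi> permutes {1..n}} \<times> {..n}) {\<sigma>. \<sigma> permutes {1..n + 1}}"
  unfolding bij_betw_def
proof (intro conjI equalityI subsetI)
  show "inj_on (\<lambda>(\<pi>, p). insert_max n p \<pi>) ({\<pi>. \<pi> permutes {1..n}} \<times> {..n})"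
  proof (rule inj_onI, clarsimp)
    fix \<pi> \<pi>' p p'
    assume perm: "\<pi> permutes {Suc 0..n}" "\<pi>' permutes {Suc 0..n}" and le: "p \<le> n" "p' \<le> n"
      and eq: "insert_max n p \<pi> = insert_max n p' \<pi>'"
    from perm have perm: "\<pi> permutes {1..n}" "\<pi>' permutes {1..n}" by simp_all
    have "insert_max n p \<pi> (p + 1) = insert_max n p \<pi> (p' + 1)"
      using insert_max_at[OF perm(1), of p] insert_max_at[OF perm(2), of p'] eq by simp
    then have "p = p'"
      using permutes_neq[OF insert_max_permutes[OF perm(1) le(1)], of "p + 1" "p' + 1"] by auto
    moreover have "surj (insertion_cycle n p)"
      using permutes_surj[OF insertion_cycle_permutes[OF le(1)]] .
    then have "\<pi> = \<pi>'" if "\<pi> \<circ> insertion_cycle n p = \<pi>' \<circ> insertion_cycle n p"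
      using that by (simp add: surj_fun_eq)
    ultimately show "\<pi> = \<pi>' \<and> p = p'"
      using eq by (simp add: insert_max_def)
  qed
next
  fix \<sigma> assume "\<sigma> \<in> (\<lambda>(\<pi>, p). insert_max n p \<pi>) ` ({\<pi>. \<pi> permutes {1..n}} \<times> {..n})"
  then show "\<sigma> \<in> {\<sigma>. \<sigma> permutes {1..n + 1}}"
    using insert_max_permutes by fastforce
next
  fix \<sigma> :: "nat \<Rightarrow> nat" assume "\<sigma> \<in> {\<sigma>. \<sigma> permutes {1..n + 1}}"
  then have \<sigma>: "\<sigma> permutes {1..n + 1}" by simp
  then have "n + 1 \<in> \<sigma> ` {1..n + 1}"
    by (simp add: permutes_image)
  then obtain p where p: "p \<le> n" "\<sigma> (p + 1) = n + 1"
    by (metis Suc_eq_plus1 Suc_le_mono atLeastAtMost_iff imageE le_add_diff_inverse2)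
  note c = insertion_cycle_permutes[OF p(1)]
  define \<pi> where "\<pi> = \<sigma> \<circ> inv (insertion_cycle n p)"
  have "inv (insertion_cycle n p) (n + 1) = p + 1"
    by (rule permutes_inv_eq[OF c, THEN iffD2]) (simp add: insertion_cycle_def)
  then have fixed: "\<pi> (n + 1) = n + 1"
    using p(2) by (simp add: \<pi>_def)
  have "\<pi> permutes {1..n + 1}"
    unfolding \<pi>_def by (rule permutes_compose[OF permutes_inv[OF c] \<sigma>])
  then have "\<pi> permutes {1..n}"
    by (rule permutes_superset) (use fixed in \<open>auto simp: le_Suc_eq\<close>)
  moreover have "insert_max n p \<pi> = \<sigma>"
    by (simp add: insert_max_def \<pi>_def comp_assoc permutes_inv_o[OF c])
  ultimately show "\<sigma> \<in> (\<lambda>(\<pi>, p). insert_max n p \<pi>) ` ({\<pi>. \<pi> permutes {1..n}} \<times> {..n})"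
    using p(1) by force
qed

section \<open>The effect of an insertion on the labels\<close>

context
  fixes n p :: nat and \<pi> :: "nat \<Rightarrow> nat"
  assumes \<pi>: "\<pi> permutes {1..n}" and p: "p \<le> n"
begin

text \<open>
  The label of a gap depends only on the entries at most two positions away, so outside the gap of
  insertion the labels stay, shifted by one to the right of it. The exceptions below come from a peak
  at position \<open>p\<close> or \<open>p + 1\<close>, which ceases to be a peak beside the new maximum.
\<close>

lemma gap_label_insert_max_before:
  assumes "q < p" "\<not> (q + 1 = p \<and> gap_label n \<pi> q \<in> {X, U})"
  shows "gap_label (n + 1) (insert_max n p \<pi>) q = gap_label n \<pi> q"
proof (cases "q + 1 = p")
  case True
  then show ?thesis
    using assms p insert_max_at[OF \<pi>, of p] permutes_le[OF \<pi>, of p]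
    by (auto simp: gap_label_def insert_max_before split: if_splits)
next
  case False
  then show ?thesis
    using assms p by (simp add: gap_label_def insert_max_before)
qed

lemma gap_label_insert_max_before_X_U:
  assumes "q + 1 = p" "gap_label n \<pi> q \<in> {X, U}"
  shows "gap_label (n + 1) (insert_max n p \<pi>) q = W"
  using assms p insert_max_at[OF \<pi>, of p] permutes_le[OF \<pi>, of p]
  by (auto simp: gap_label_def insert_max_before split: if_splits)

lemma gap_label_insert_max_after:
  assumes "p < q" "q \<le> n" "\<not> (q = p + 1 \<and> gap_label n \<pi> p \<in> {X, U})"
  shows "gap_label (n + 1) (insert_max n p \<pi>) (q + 1) = gap_label n \<pi> q"
proof (cases "q = p + 1")
  case True
  then show ?thesis
    using assms insert_max_at[OF \<pi>, of p] insert_max_after[of p q n \<pi>]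
      insert_max_after[of p "q + 1" n \<pi>] insert_max_after[of p "q + 2" n \<pi>]
      permutes_le[OF \<pi>, of q] permutes_neq[OF \<pi>, of q "q + 1"]
    by (auto simp: gap_label_def split: if_splits)
next
  case False
  then show ?thesis
    using assms insert_max_after[of p q n \<pi>] insert_max_after[of p "q - 1" n \<pi>]
      insert_max_after[of p "q + 1" n \<pi>] insert_max_after[of p "q + 2" n \<pi>]
    by (auto simp: gap_label_def)
qed

lemma gap_label_insert_max_after_X_U:
  assumes "gap_label n \<pi> p \<in> {X, U}"
  shows "gap_label (n + 1) (insert_max n p \<pi>) (p + 2) = Y"
proof -
  have "p + 1 < n"
    using assms by (auto simp: gap_label_def split: if_splits)
  then show ?thesis
    using assms insert_max_at[OF \<pi>, of p] insert_max_after[of p "p + 1" n \<pi>]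
      insert_max_after[of p "p + 2" n \<pi>] permutes_le[OF \<pi>, of "p + 1"]
    by (auto simp: gap_label_def split: if_splits)
qed

lemma gap_label_insert_max_new:
  "gap_label (n + 1) (insert_max n p \<pi>) p =
     (if p = n then W else if \<pi> p < \<pi> (p + 1) then X else U)"
  "gap_label (n + 1) (insert_max n p \<pi>) (p + 1) =
     (if p = n then Z else if \<pi> p < \<pi> (p + 1) then V else Z)"
  using p insert_max_at[OF \<pi>, of p] insert_max_after[of p "p + 1" n \<pi>]
    permutes_le[OF \<pi>, of p] permutes_le[OF \<pi>, of "p + 1"]
  by (cases "p = n"; simp add: gap_label_def insert_max_before)+

text \<open>
  In the exceptional cases the old and the new product differ in one factor, the label of the
  other gap around the destroyed peak. The common part is named instead of cancelled, because the
  target is an arbitrary commutative monoid.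
\<close>

lemma prod_gap_label_before:
  fixes f :: "letter \<Rightarrow> 'a::comm_monoid_mult"
  shows prod_gap_label_before_same: "p = n \<or> gap_label n \<pi> p \<notin> {V, Z} \<Longrightarrow>
      (\<Prod>q<p. f (gap_label (n + 1) (insert_max n p \<pi>) q)) = (\<Prod>q<p. f (gap_label n \<pi> q))"
    and prod_gap_label_before_V_Z: "p < n \<Longrightarrow> gap_label n \<pi> p \<in> {V, Z} \<Longrightarrow>
      \<exists>A. (\<Prod>q<p. f (gap_label (n + 1) (insert_max n p \<pi>) q)) = A * f W \<and>
          (\<Prod>q<p. f (gap_label n \<pi> q)) = A * f (if gap_label n \<pi> p = V then X else U)"
proof -
  assume *: "p = n \<or> gap_label n \<pi> p \<notin> {V, Z}"
  have "gap_label (n + 1) (insert_max n p \<pi>) q = gap_label n \<pi> q" if "q < p" for q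
    using gap_label_insert_max_before[OF that] gap_label_X_next[of n \<pi> q]
      gap_label_U_next[of n \<pi> q] * by auto
  then show "(\<Prod>q<p. f (gap_label (n + 1) (insert_max n p \<pi>) q)) = (\<Prod>q<p. f (gap_label n \<pi> q))"
    by simp
next
  assume "p < n" "gap_label n \<pi> p \<in> {V, Z}"
  then obtain r where r: "p = Suc r" "gap_label n \<pi> r = (if gap_label n \<pi> p = V then X else U)"
    using gap_label_V_Z_prev(2)[OF \<pi>] by blast
  have W: "gap_label (n + 1) (insert_max n p \<pi>) r = W"
    using r by (intro gap_label_insert_max_before_X_U) auto
  have "(\<Prod>q<r. f (gap_label (n + 1) (insert_max n p \<pi>) q)) = (\<Prod>q<r. f (gap_label n \<pi> q))"
    using r(1) by (intro prod.cong refl arg_cong[of _ _ f] gap_label_insert_max_before) auto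
  then have "(\<Prod>q<p. f (gap_label (n + 1) (insert_max n p \<pi>) q)) = (\<Prod>q<r. f (gap_label n \<pi> q)) * f W"
    unfolding r(1) using W r(1) by simp
  moreover have "(\<Prod>q<p. f (gap_label n \<pi> q)) =
      (\<Prod>q<r. f (gap_label n \<pi> q)) * f (if gap_label n \<pi> p = V then X else U)"
    unfolding r(2)[symmetric] by (simp add: r(1))
  ultimately show "\<exists>A. (\<Prod>q<p. f (gap_label (n + 1) (insert_max n p \<pi>) q)) = A * f W \<and>
          (\<Prod>q<p. f (gap_label n \<pi> q)) = A * f (if gap_label n \<pi> p = V then X else U)"
    by blast
qed

lemma prod_gap_label_after:
  fixes f :: "letter \<Rightarrow> 'a::comm_monoid_mult"
  shows prod_gap_label_after_same: "gap_label n \<pi> p \<notin> {X, U} \<Longrightarrow>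
      (\<Prod>q\<in>{p<..n}. f (gap_label (n + 1) (insert_max n p \<pi>) (q + 1))) =
      (\<Prod>q\<in>{p<..n}. f (gap_label n \<pi> q))"
    and prod_gap_label_after_X_U: "gap_label n \<pi> p \<in> {X, U} \<Longrightarrow>
      \<exists>B. (\<Prod>q\<in>{p<..n}. f (gap_label (n + 1) (insert_max n p \<pi>) (q + 1))) = f Y * B \<and>
          (\<Prod>q\<in>{p<..n}. f (gap_label n \<pi> q)) = f (if gap_label n \<pi> p = X then V else Z) * B"
proof -
  assume "gap_label n \<pi> p \<notin> {X, U}"
  then show "(\<Prod>q\<in>{p<..n}. f (gap_label (n + 1) (insert_max n p \<pi>) (q + 1))) =
      (\<Prod>q\<in>{p<..n}. f (gap_label n \<pi> q))"
    by (intro prod.cong refl arg_cong[of _ _ f] gap_label_insert_max_after) auto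
next
  assume *: "gap_label n \<pi> p \<in> {X, U}"
  then have next_peak: "p + 1 \<le> n" "gap_label n \<pi> (p + 1) = (if gap_label n \<pi> p = X then V else Z)"
    using gap_label_X_next[of n \<pi> p] gap_label_U_next[of n \<pi> p] by auto
  have split: "{p<..n} = insert (p + 1) {p + 1<..n}"
    using next_peak(1) by auto
  have new: "gap_label (n + 1) (insert_max n p \<pi>) (p + 1 + 1) = Y"
    using gap_label_insert_max_after_X_U[OF *] by (simp add: numeral_2_eq_2)
  have "(\<Prod>q\<in>{p + 1<..n}. f (gap_label (n + 1) (insert_max n p \<pi>) (q + 1))) =
      (\<Prod>q\<in>{p + 1<..n}. f (gap_label n \<pi> q))"
    by (intro prod.cong refl arg_cong[of _ _ f] gap_label_insert_max_after) auto
  then have "(\<Prod>q\<in>{p<..n}. f (gap_label (n + 1) (insert_max n p \<pi>) (q + 1))) =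
      f Y * (\<Prod>q\<in>{p + 1<..n}. f (gap_label n \<pi> q))"
    unfolding split using new by (subst prod.insert) auto
  moreover have "(\<Prod>q\<in>{p<..n}. f (gap_label n \<pi> q)) =
      f (if gap_label n \<pi> p = X then V else Z) * (\<Prod>q\<in>{p + 1<..n}. f (gap_label n \<pi> q))"
    unfolding split next_peak(2)[symmetric] by (subst prod.insert) auto
  ultimately show "\<exists>B. (\<Prod>q\<in>{p<..n}. f (gap_label (n + 1) (insert_max n p \<pi>) (q + 1))) = f Y * B \<and>
          (\<Prod>q\<in>{p<..n}. f (gap_label n \<pi> q)) = f (if gap_label n \<pi> p = X then V else Z) * B"
    by blast
qed

text \<open>
  Write the product of the new labels as (gaps before \<open>p\<close>) times (the two
  halves of gap \<open>p\<close>) times (gaps after \<open>p\<close>). The two halves are \<open>x v\<close> at an ascent, \<open>u z\<close>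
  at a descent and \<open>w z\<close> at the end. The outer factors change only if \<open>p\<close> is adjacent to a peak,
  which the insertion destroys: its first gap becomes \<open>w\<close> or its second gap becomes \<open>y\<close>. In each case
  the quotient of the new and the old labels is the right-hand side of the rule divided by its
  left-hand side.
\<close>

lemma prod_gap_label_insert_max:
  "(\<Prod>q\<le>n + 1. var (gap_label (n + 1) (insert_max n p \<pi>) q)) =
     peak_grammar (gap_label n \<pi> p)
       * (\<Prod>q\<in>{..n} - {p}. var (gap_label n \<pi> q) :: (letter, 'a::comm_ring_1) laurent)"
proof -
  let ?v = "var :: letter \<Rightarrow> (letter, 'a) laurent"
  let ?L = "gap_label n \<pi>" and ?L' = "gap_label (n + 1) (insert_max n p \<pi>)"
  define A where "A = (\<Prod>q<p. ?v (?L q))"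
  define A' where "A' = (\<Prod>q<p. ?v (?L' q))"
  define B where "B = (\<Prod>q\<in>{p<..n}. ?v (?L q))"
  define B' where "B' = (\<Prod>q\<in>{p<..n}. ?v (?L' (q + 1)))"
  note [simp] = var_inverse
  have old: "(\<Prod>q\<in>{..n} - {p}. ?v (?L q)) = A * B"
  proof -
    have "{..n} - {p} = {..<p} \<union> {p<..n}"
      using p by auto
    then show ?thesis
      unfolding A_def B_def by (simp add: prod.union_disjoint disjoint_iff)
  qed
  have new: "(\<Prod>q\<le>n + 1. ?v (?L' q)) = A' * (?v (?L' p) * ?v (?L' (p + 1))) * B'"
  proof -
    have "x \<in> Suc ` {p<..n} \<longleftrightarrow> p + 1 < x \<and> x \<le> n + 1" for x
      by (cases x) auto
    then have "{..n + 1} = {..<p} \<union> {p, p + 1} \<union> Suc ` {p<..n}"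
      using p by (intro set_eqI) auto
    moreover have "(\<Prod>q\<in>Suc ` {p<..n}. ?v (?L' q)) = B'"
      unfolding B'_def by (subst prod.reindex) auto
    moreover have "({..<p} \<union> {p, p + 1}) \<inter> Suc ` {p<..n} = {}" "{..<p} \<inter> {p, p + 1} = {}"
      by auto
    ultimately show ?thesis
      unfolding A'_def by (simp add: prod.union_disjoint)
  qed
  note before = prod_gap_label_before_same[of ?v, folded A_def A'_def]
    and before_peak = prod_gap_label_before_V_Z[of ?v, folded A_def A'_def]
    and after = prod_gap_label_after_same[of ?v, folded B_def B'_def]
    and after_peak = prod_gap_label_after_X_U[of ?v, folded B_def B'_def]
    and mid = gap_label_insert_max_new[simplified]
  have last: "?L p = Z" if "p = n"
    using that by (simp add: gap_label_def)
  have "A' * (?v (?L' p) * ?v (?L' (p + 1))) * B' = peak_grammar (?L p) * (A * B)"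
  proof (cases "?L p")
    case X
    then have "A' = A" "?L' p = X" "?L' (p + 1) = V"
      using before last gap_label_X_next[of n \<pi> p] by (auto simp: mid)
    moreover obtain C where "B' = ?v Y * C" "B = ?v V * C"
      using after_peak X by auto
    ultimately show ?thesis
      by (simp add: X ac_simps)
  next
    case U
    then have "A' = A" "?L' p = X" "?L' (p + 1) = V"
      using before last gap_label_U_next[of n \<pi> p] by (auto simp: mid)
    moreover obtain C where "B' = ?v Y * C" "B = ?v Z * C"
      using after_peak U by auto
    moreover have "peak_grammar U * (A * (?v Z * C)) =
        (?v Z * var_pow Z (-1)) * (?v X * ?v Y * ?v V * A * C)"
      by (simp only: peak_grammar.simps ac_simps)
    ultimately show ?thesis
      by (simp add: U ac_simps)
  next
    case V
    have "p < n"
      using last V p by (cases "p = n") auto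
    then have "B' = B" "?L' p = U" "?L' (p + 1) = Z"
      using after V gap_label_V_Z_prev(1)[OF \<pi>, of p] by (auto simp: mid)
    moreover obtain C where "A' = C * ?v W" "A = C * ?v X"
      using before_peak V \<open>p < n\<close> by auto
    moreover have "peak_grammar V * (C * ?v X * B) =
        (?v X * var_pow X (-1)) * (?v Z * ?v W * ?v U * C * B)"
      by (simp only: peak_grammar.simps ac_simps)
    ultimately show ?thesis
      by (simp add: V ac_simps)
  next
    case Z
    show ?thesis
    proof (cases "p = n")
      case True
      then have "A' = A" "B' = B" "?L' p = W" "?L' (p + 1) = Z"
        using before after Z mid by auto
      then show ?thesis
        by (simp add: Z ac_simps)
    next
      case False
      then have "p < n"
        using p by simp
      then have "B' = B" "?L' p = U" "?L' (p + 1) = Z"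
        using after Z gap_label_V_Z_prev(1)[OF \<pi>, of p] by (auto simp: mid)
      moreover obtain C where "A' = C * ?v W" "A = C * ?v U"
        using before_peak Z \<open>p < n\<close> by auto
      ultimately show ?thesis
        by (simp add: Z ac_simps)
    qed
  next
    case Y
    then have "p \<noteq> n" "\<not> \<pi> p < \<pi> (p + 1)"
      by (auto simp: gap_label_def split: if_splits)
    then have "A' = A" "B' = B" "?L' p = U" "?L' (p + 1) = Z"
      using before after Y by (auto simp: mid)
    then show ?thesis
      by (simp add: Y ac_simps)
  next
    case W
    then have "p \<noteq> n" "\<pi> p < \<pi> (p + 1)"
      by (auto simp: gap_label_def split: if_splits)
    then have "A' = A" "B' = B" "?L' p = X" "?L' (p + 1) = V"
      using before after W by (auto simp: mid)
    then show ?thesis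
      by (simp add: W ac_simps)
  qed
  then show ?thesis
    unfolding old new .
qed

end

section \<open>Iterating the derivative\<close>

text \<open>
  By the product rule, the summand of \<open>D\<close> that differentiates the label of gap \<open>p\<close> of \<open>\<pi>\<close> is the label
  product of the permutation in which \<open>n + 1\<close> has been inserted there.
\<close>

lemma formal_derivative_sum_gap_labels:
  "formal_derivative peak_grammar (\<Sum>\<pi> | \<pi> permutes {1..n}. \<Prod>q\<le>n. var (gap_label n \<pi> q)) =
   (\<Sum>\<sigma> | \<sigma> permutes {1..n + 1}. \<Prod>q\<le>n + 1.
      var (gap_label (n + 1) \<sigma> q) :: (letter, 'a::comm_ring_1) laurent)"
proof -
  let ?P = "{\<pi>. \<pi> permutes {1..n}}"
  let ?wt = "\<lambda>\<sigma>. \<Prod>q\<le>n + 1. var (gap_label (n + 1) \<sigma> q) :: (letter, 'a) laurent"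
  have "formal_derivative peak_grammar (\<Sum>\<pi>\<in>?P. \<Prod>q\<le>n. var (gap_label n \<pi> q)) =
      (\<Sum>\<pi>\<in>?P. \<Sum>p\<le>n. ?wt (insert_max n p \<pi>))"
    by (simp add: formal_derivative_sum formal_derivative_prod formal_derivative_var
        prod_gap_label_insert_max[simplified])
  also have "\<dots> = (\<Sum>x\<in>?P \<times> {..n}. ?wt ((\<lambda>(\<pi>, p). insert_max n p \<pi>) x))"
    by (simp add: sum.cartesian_product split_beta)
  also have "\<dots> = (\<Sum>\<sigma> | \<sigma> permutes {1..n + 1}. ?wt \<sigma>)"
    by (rule sum.reindex_bij_betw[OF bij_betw_insert_max])
  finally show ?thesis .
qed

theorem theorem2p1:
  fixes n :: nat
  shows "(formal_derivative peak_grammar ^^ n) (var Z) = (peak_poly n :: (letter, 'a::comm_ring_1) laurent)"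
  unfolding peak_poly_eq_sum_gap_labels
proof (induction n)
  case 0
  show ?case
    by (simp add: gap_label_def)
next
  case (Suc n)
  then show ?case
    using formal_derivative_sum_gap_labels[of n] by simp
qed

end
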